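(* Let $\mu,\gamma>0$, $\alpha_0\in\mathbb{R}$, and let $u_0:\mathbb{T}\to\mathbb{R}$ be a Lipschitz function, $\mathbb{T}=\mathbb{R}/\mathbb{Z}$. Let $\sigma\in C^1(\mathbb{R})$ be such that there is $C_1>0$ with $\sigma(a)\ge C_1$ for all $a\in\mathbb{R}$, $a\,\sigma_\alpha(a)\ge0$ for all $a\in\mathbb{R}$, and there is $L>0$ with $|\sigma_\alpha(a)-\sigma_\alpha(b)|\le L|a-b|$ for all $a,b\in\mathbb{R}$. Let $(u,\alpha)$ be a time global solution of system (S) (see context) with initial data $(u_0,\alpha_0)$. Then there exists a constant $u_\infty\in\mathbb{R}$ such that $\|u(\cdot,t)-u_\infty\|_{C^2(\mathbb{T})}$ goes to $0$ exponentially as $t\to\infty$. In addition, the curvature $\kappa=\bigl(u_x/\sqrt{1+u_x^2}\bigr)_x$ also goes to $0$ uniformly and exponentially on $\mathbb{T}$ as $t\to\infty$.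
   Context: $\sigma_\alpha$ denotes the derivative of $\sigma$. System (S): $u:\mathbb{T}\times[0,\infty)\to\mathbb{R}$ and $\alpha:[0,\infty)\to\mathbb{R}$ satisfy $$\frac{u_t}{\sqrt{1+u_x^2}}=\mu\sigma(\alpha)\Bigl(\frac{u_x}{\sqrt{1+u_x^2}}\Bigr)_x\ (x\in\mathbb{T},\,t>0),\qquad \alpha_t=-\gamma\,\sigma_\alpha(\alpha)\,|\Gamma_t|\ (t>0),\qquad u(x,0)=u_0(x),\ \alpha(0)=\alpha_0,$$ with $|\Gamma_t|=\int_0^1\sqrt{1+u_x^2}\,dx$. A time global solution is one that is classical for all $t>0$ (for every $0<\varepsilon<T<\infty$ and a fixed $\beta\in(0,1)$, $u$ is in $C(\mathbb{T}\times[0,T])$ and in the parabolic Hölder space $C^{2,\beta}(\mathbb{T}\times(\varepsilon,T))$, and $\alpha\in C([0,T))\cap C^{1,1}((\varepsilon,T))$), attaining the initial data continuously. "$g(t)$ goes to $0$ exponentially" means there are $C,\lambda,t_1>0$ with $|g(t)|\le Ce^{-\lambda t}$ for all $t\ge t_1$. *)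

theory Defs
  imports "HOL-Analysis.Analysis"
begin

text \<open>
  Functions on the torus \<open>\<real>/\<int>\<close> are represented by 1-periodic functions on the reals.  By
  periodicity, a (parabolic) Hoelder or Lipschitz bound on the torus is the same as the bound with
  \<open>\<bar>x - y\<bar>\<close> for all real \<open>x\<close>, \<open>y\<close>.
\<close>

definition periodic1 :: "(real \<Rightarrow> real) \<Rightarrow> bool"
  where "periodic1 f \<longleftrightarrow> (\<forall>x. f (x + 1) = f x)"

definition dx :: "(real \<Rightarrow> real \<Rightarrow> real) \<Rightarrow> real \<Rightarrow> real \<Rightarrow> real"
  where "dx u x t = deriv (\<lambda>y. u y t) x"

definition dt :: "(real \<Rightarrow> real \<Rightarrow> real) \<Rightarrow> real \<Rightarrow> real \<Rightarrow> real"
  where "dt u x t = deriv (\<lambda>s. u x s) t"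

definition curvature :: "(real \<Rightarrow> real \<Rightarrow> real) \<Rightarrow> real \<Rightarrow> real \<Rightarrow> real"
  where "curvature u = dx (\<lambda>x t. dx u x t / sqrt (1 + (dx u x t)\<^sup>2))"

definition curve_length :: "(real \<Rightarrow> real \<Rightarrow> real) \<Rightarrow> real \<Rightarrow> real"
  where "curve_length u t = integral {0..1} (\<lambda>x. sqrt (1 + (dx u x t)\<^sup>2))"

definition bounded_continuous_on :: "(real \<times> real) set \<Rightarrow> (real \<Rightarrow> real \<Rightarrow> real) \<Rightarrow> bool"
  where "bounded_continuous_on S f \<longleftrightarrow>
    continuous_on S (\<lambda>(x, t). f x t) \<and> bounded ((\<lambda>(x, t). f x t) ` S)"

definition parabolic_holder_on :: "real \<Rightarrow> (real \<times> real) set \<Rightarrow> (real \<Rightarrow> real \<Rightarrow> real) \<Rightarrow> bool"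
  where "parabolic_holder_on \<beta> S f \<longleftrightarrow>
    bounded_continuous_on S f \<and>
    (\<exists>C. \<forall>(x, t)\<in>S. \<forall>(y, s)\<in>S.
      \<bar>f x t - f y s\<bar> \<le> C * (\<bar>x - y\<bar> + sqrt \<bar>t - s\<bar>) powr \<beta>)"

text \<open>
  The parabolic space \<open>C\<^sup>2\<^sup>,\<^sup>\<beta>\<close>, also written \<open>C\<^sup>2\<^sup>+\<^sup>\<beta>\<^sup>,\<^sup>1\<^sup>+\<^sup>\<beta>\<^sup>/\<^sup>2\<close>; one time derivative counts as two
  space derivatives.  The differentiability conditions make all uses of \<^const>\<open>deriv\<close> meaningful
  (\<open>S\<close> is open in the application).
\<close>

definition parabolic_C2_on :: "real \<Rightarrow> (real \<times> real) set \<Rightarrow> (real \<Rightarrow> real \<Rightarrow> real) \<Rightarrow> bool"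
  where "parabolic_C2_on \<beta> S u \<longleftrightarrow>
    (\<forall>(x, t)\<in>S. (\<lambda>y. u y t) differentiable (at x) \<and>
                (\<lambda>y. dx u y t) differentiable (at x) \<and>
                (\<lambda>s. u x s) differentiable (at t)) \<and>
    bounded_continuous_on S u \<and>
    bounded_continuous_on S (dx u) \<and>
    parabolic_holder_on \<beta> S (dx (dx u)) \<and>
    parabolic_holder_on \<beta> S (dt u)"

definition C11_on :: "real set \<Rightarrow> (real \<Rightarrow> real) \<Rightarrow> bool"
  where "C11_on S a \<longleftrightarrow>
    (\<forall>t\<in>S. a differentiable (at t)) \<and> bounded (a ` S) \<and> bounded (deriv a ` S) \<and>
    (\<exists>L. L-lipschitz_on S (deriv a))"

text \<open>
  Only the values of \<open>u\<close> and \<open>\<alpha>\<close> at times \<open>t \<ge> 0\<close> matter.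
\<close>

definition global_solution ::
  "real \<Rightarrow> real \<Rightarrow> real \<Rightarrow> (real \<Rightarrow> real) \<Rightarrow> (real \<Rightarrow> real) \<Rightarrow> real \<Rightarrow>
   (real \<Rightarrow> real \<Rightarrow> real) \<Rightarrow> (real \<Rightarrow> real) \<Rightarrow> bool"
  where "global_solution \<beta> \<mu> \<gamma> \<sigma> u0 \<alpha>0 u \<alpha> \<longleftrightarrow>
    (\<forall>t\<ge>0. periodic1 (\<lambda>x. u x t)) \<and>
    (\<forall>\<epsilon> T. 0 < \<epsilon> \<and> \<epsilon> < T \<longrightarrow>
       continuous_on (UNIV \<times> {0..T}) (\<lambda>(x, t). u x t) \<and>
       parabolic_C2_on \<beta> (UNIV \<times> {\<epsilon><..<T}) u \<and>
       continuous_on {0..<T} \<alpha> \<and>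
       C11_on {\<epsilon><..<T} \<alpha>) \<and>
    (\<forall>x. \<forall>t>0. dt u x t / sqrt (1 + (dx u x t)\<^sup>2) = \<mu> * \<sigma> (\<alpha> t) * curvature u x t) \<and>
    (\<forall>t>0. deriv \<alpha> t = - \<gamma> * deriv \<sigma> (\<alpha> t) * curve_length u t) \<and>
    (\<forall>x. u x 0 = u0 x) \<and>
    \<alpha> 0 = \<alpha>0"

text \<open>
  The suprema below are those of the reals, so they are only meaningful for bounded functions, such
  as the continuous periodic ones.
\<close>

definition sup_norm :: "(real \<Rightarrow> real) \<Rightarrow> real"
  where "sup_norm f = (SUP x. \<bar>f x\<bar>)"

definition C2_norm :: "(real \<Rightarrow> real) \<Rightarrow> real"
  where "C2_norm f = sup_norm f + sup_norm (deriv f) + sup_norm (deriv (deriv f))"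

definition exponentially_to_0 :: "(real \<Rightarrow> real) \<Rightarrow> bool"
  where "exponentially_to_0 g \<longleftrightarrow>
    (\<exists>C>0. \<exists>r>0. \<exists>t1>0. \<forall>t\<ge>t1. \<bar>g t\<bar> \<le> C * exp (- r * t))"

end

theory Submission
  imports Defs "HOL-Library.Periodic_Fun"
begin

text \<open>
  Carrying out the differentiation, the equation reads \<open>u\<^sub>t = m(t) u\<^sub>x\<^sub>x / (1 + u\<^sub>x\<^sup>2)\<close> with
  \<open>m = \<mu> \<sigma>(\<alpha>)\<close> continuous and bounded below by a positive constant, so in the new time \<open>\<integral> m\<close>
  it is the autonomous equation \<open>v\<^sub>t = v\<^sub>x\<^sub>x / (1 + v\<^sub>x\<^sup>2)\<close>.  Comparing \<open>v\<close> with its translates in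
  space and in time bounds \<open>v\<^sub>x\<close> and \<open>v\<^sub>t\<close>, hence also \<open>v\<^sub>x\<^sub>x\<close>.  The difference \<open>w\<close> of \<open>v\<close> and
  its time translate by \<open>h\<close> then satisfies a uniformly parabolic inequality, and doubling the
  variables shows that \<open>w(x,t) - w(y,t)\<close> stays below a barrier \<open>C h e\<^sup>-\<^sup>r\<^sup>t \<phi>(x - y)\<close>; as \<open>h \<rightarrow> 0\<close> the
  oscillation of \<open>v\<^sub>t\<close> decays exponentially.  No regularity beyond \<open>v\<^sub>x\<^sub>x\<close> and \<open>v\<^sub>t\<close> is needed.  Since
  \<open>v\<^sub>x\<close> is periodic, \<open>v\<^sub>x\<^sub>x\<close> and with it \<open>v\<^sub>t\<close> vanishes somewhere, so \<open>v\<^sub>t\<close> and \<open>v\<^sub>x\<^sub>x\<close> decay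
  exponentially; the decay of \<open>v\<^sub>x\<close> and the convergence of \<open>v\<close> follow by integration.
\<close>

section \<open>Maximum principle at the first touching time\<close>

text \<open>The pairs with \<open>\<Phi> \<ge> 0\<close> form a compact set, so a violation has an
  earliest time \<open>t0\<close>. Passing to the limit from earlier times gives
  \<open>\<Phi> \<le> 0\<close> everywhere at \<open>t0\<close>, while a negative time derivative at
  the touching point would make \<open>\<Phi>\<close> positive just before
  \<open>t0\<close>.\<close>

lemma first_touching:
  fixes \<Phi> :: "'a :: metric_space \<Rightarrow> real \<Rightarrow> real"
  assumes S: "compact S" and cont: "continuous_on (S \<times> {0..T}) (\<lambda>(z, t). \<Phi> z t)"
    and init: "\<And>z. z \<in> S \<Longrightarrow> \<Phi> z 0 < 0"
    and touch: "\<And>z t. \<lbrakk>z \<in> S; 0 < t; t \<le> T; \<Phi> z t = 0; \<forall>y\<in>S. \<Phi> y t \<le> 0\<rbrakk> \<Longrightarrow>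
      \<exists>D<0. (\<Phi> z has_real_derivative D) (at t)"
    and z: "z \<in> S" and t: "0 \<le> t" "t \<le> T"
  shows "\<Phi> z t < 0"
proof (rule ccontr)
  assume neg: "\<not> \<Phi> z t < 0"
  define Z where "Z = {p \<in> S \<times> {0..T}. (\<lambda>(z, t). \<Phi> z t) p \<in> {0..}}"
  have "closedin (top_of_set (S \<times> {0..T})) Z"
    unfolding Z_def using continuous_closedin_preimage[OF cont, of "{0..}"]
    by (simp add: vimage_def Int_def)
  then have "compact Z"
    using closedin_compact S compact_Times compact_Icc by blast
  moreover have "(z, t) \<in> Z"
    using neg z t by (auto simp: Z_def)
  ultimately obtain t0 where t0: "t0 \<in> snd ` Z" "\<And>s. s \<in> snd ` Z \<Longrightarrow> t0 \<le> s"
    using compact_attains_inf[of "snd ` Z"] compact_continuous_image[OF continuous_on_snd[OF continuous_on_id], of Z]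
    by (metis empty_iff image_is_empty)
  then obtain z0 where z0: "z0 \<in> S" "0 \<le> t0" "t0 \<le> T" "\<Phi> z0 t0 \<ge> 0"
    by (auto simp: Z_def)
  have before: "\<Phi> y s < 0" if "y \<in> S" "0 \<le> s" "s < t0" for y s
  proof (rule ccontr)
    assume "\<not> \<Phi> y s < 0"
    then have "(y, s) \<in> Z" using that z0 by (auto simp: Z_def)
    then have "t0 \<le> s" using t0(2) by force
    then show False using that by simp
  qed
  have pos: "0 < t0"
    using init[OF z0(1)] z0 by (cases "t0 = 0") auto
  have le: "\<Phi> y t0 \<le> 0" if y: "y \<in> S" for y
  proof (rule continuous_le_on_closure[where f = "\<Phi> y" and S = "{0..<t0}"])
    have "continuous_on {0..t0} (\<lambda>s. case (y, s) of (z, t) \<Rightarrow> \<Phi> z t)"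
      by (rule continuous_on_compose2[OF cont]) (use y z0 in \<open>auto intro!: continuous_intros\<close>)
    then show "continuous_on (closure {0..<t0}) (\<Phi> y)" using pos by simp
  qed (use pos before[OF y] in \<open>auto intro: less_imp_le\<close>)
  obtain D where "D < 0" "(\<Phi> z0 has_real_derivative D) (at t0)"
    using touch[of z0 t0] z0 pos le by (metis order_antisym)
  then obtain d where d: "d > 0" "\<And>h. 0 < h \<Longrightarrow> h < d \<Longrightarrow> \<Phi> z0 t0 < \<Phi> z0 (t0 - h)"
    using DERIV_neg_dec_left by blast
  define h where "h = min d t0 / 2"
  have "0 < h" "h < d" "h < t0" using d pos by (auto simp: h_def)
  then show False
    using d(2)[of h] before[of z0 "t0 - h"] z0 by auto
qed

text \<open>If \<open>l > 0\<close>, then \<open>f'\<close> is positive just to the right of the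
  critical point \<open>x\<close>, and the mean value theorem makes \<open>f\<close> larger there
  than at its maximum. Differentiability of \<open>f'\<close> at the single point \<open>x\<close>
  suffices.\<close>

lemma second_derivative_test:
  fixes f f' :: "real \<Rightarrow> real"
  assumes f: "\<And>y. (f has_real_derivative f' y) (at y)"
    and f': "(f' has_real_derivative l) (at x)"
    and e: "e > 0" and max: "\<And>y. \<bar>y - x\<bar> < e \<Longrightarrow> f y \<le> f x"
  shows "f' x = 0" and "l \<le> 0"
proof -
  show z: "f' x = 0"
    by (rule DERIV_local_max[OF f e]) (use max in \<open>auto simp: abs_minus_commute\<close>)
  show "l \<le> 0"
  proof (rule ccontr)
    assume "\<not> l \<le> 0"
    then obtain d where d: "d > 0" "\<And>h. 0 < h \<Longrightarrow> h < d \<Longrightarrow> f' x < f' (x + h)"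
      using DERIV_pos_inc_right[OF f'] by auto
    define h where "h = min d e / 2"
    have h: "0 < h" "h < d" "h < e" using d e by (auto simp: h_def)
    obtain c where c: "x < c" "c < x + h" "f (x + h) - f x = h * f' c"
      using MVT2[of x "x + h" f f'] h f by auto
    have "f' c > 0" using d(2)[of "c - x"] c h z by auto
    then have "f (x + h) - f x > 0" using c h by simp
    then show False using max[of "x + h"] h by auto
  qed
qed

text \<open>These identities let the maximum principle run on the compact period
  \<open>[0, 1]\<close>. The first reduces a base point and a shift separately, as the doubling of
  variables requires.\<close>

lemma periodic_1_reduce:
  fixes f :: "real \<Rightarrow> real"
  assumes "\<And>x. f (x + 1) = f x"
  shows "f (frac y + frac s) = f (y + s)" and "f (frac y) = f y"
proof -
  interpret periodic_fun_simple' f using assms by unfold_locales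
  have "frac y + frac s = y + s - of_int (\<lfloor>y\<rfloor> + \<lfloor>s\<rfloor>)" by (simp add: frac_def)
  then show "f (frac y + frac s) = f (y + s)" by (metis minus_of_int)
  show "f (frac y) = f y" unfolding frac_def by (rule minus_of_int)
qed

text \<open>The difference is \<open>q - p\<close> times \<open>p + q\<close> over the product of
  the denominators, and \<open>2 * \<bar>x\<bar> \<le> 1 + x\<^sup>2\<close> keeps that second
  factor at most 1 in absolute value. So the diffusion coefficient is Lipschitz in the
  slope.\<close>

lemma abs_diff_inverse_one_plus_square_le:
  fixes p q :: real
  shows "\<bar>1 / (1 + p\<^sup>2) - 1 / (1 + q\<^sup>2)\<bar> \<le> \<bar>p - q\<bar>"
proof -
  have pos: "1 + p\<^sup>2 > 0" "1 + q\<^sup>2 > 0" by (auto intro: add_pos_nonneg)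
  have ab: "\<bar>x\<bar> \<le> (1 + x\<^sup>2) / 2" for x :: real
    using zero_le_power2[of "\<bar>x\<bar> - 1"] by (simp add: power2_eq_square algebra_simps)
  have "\<bar>p + q\<bar> \<le> 1 + (p\<^sup>2 + q\<^sup>2) / 2" using ab[of p] ab[of q] by argo
  also have "\<dots> \<le> (1 + p\<^sup>2) * (1 + q\<^sup>2)" by (simp add: algebra_simps add_increasing)
  finally have *: "\<bar>p + q\<bar> / ((1 + p\<^sup>2) * (1 + q\<^sup>2)) \<le> 1" using pos by simp
  have "1 / (1 + p\<^sup>2) - 1 / (1 + q\<^sup>2) = (q - p) * (p + q) / ((1 + p\<^sup>2) * (1 + q\<^sup>2))"
    using pos by (simp add: field_simps power2_eq_square)
  then have "\<bar>1 / (1 + p\<^sup>2) - 1 / (1 + q\<^sup>2)\<bar> = \<bar>p - q\<bar> * (\<bar>p + q\<bar> / ((1 + p\<^sup>2) * (1 + q\<^sup>2)))"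
    using pos by (simp add: abs_mult abs_minus_commute)
  also have "\<dots> \<le> \<bar>p - q\<bar> * 1" using * by (intro mult_left_mono) auto
  finally show ?thesis by simp
qed

section \<open>The autonomous graph flow and the comparison principle\<close>

text \<open>\<open>p\<close> and \<open>q\<close> stand for the first and second space derivatives
  of \<open>v\<close>. Time derivatives are two-sided even at \<open>t = 0\<close>, which fits a
  solution restarted at a positive time.\<close>

locale graph_flow =
  fixes v p q :: "real \<Rightarrow> real \<Rightarrow> real"
  assumes periodic: "0 \<le> t \<Longrightarrow> v (x + 1) t = v x t"
    and cont: "continuous_on (UNIV \<times> {0..}) (\<lambda>(x, t). v x t)"
    and dv: "0 \<le> t \<Longrightarrow> ((\<lambda>y. v y t) has_real_derivative p x t) (at x)"
    and dp: "0 \<le> t \<Longrightarrow> ((\<lambda>y. p y t) has_real_derivative q x t) (at x)"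
    and evolution: "0 \<le> t \<Longrightarrow> ((\<lambda>s. v x s) has_real_derivative q x t / (1 + (p x t)\<^sup>2)) (at t)"
begin

text \<open>The equation does not depend explicitly on space or time, so every translate can serve
  as a competitor in the comparison arguments.\<close>

lemma translate:
  assumes b: "0 \<le> b"
  shows "graph_flow (\<lambda>x t. v (x + a) (t + b)) (\<lambda>x t. p (x + a) (t + b)) (\<lambda>x t. q (x + a) (t + b))"
proof
  show "v (x + 1 + a) (t + b) = v (x + a) (t + b)" if "0 \<le> t" for x t
    using periodic[of "t + b" "x + a"] that b by (simp add: algebra_simps)
  have "continuous_on (UNIV \<times> {0..}) (\<lambda>z. case (fst z + a, snd z + b) of (x, t) \<Rightarrow> v x t)"
    by (rule continuous_on_compose2[OF cont]) (use b in \<open>auto intro!: continuous_intros\<close>)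
  then show "continuous_on (UNIV \<times> {0..}) (\<lambda>(x, t). v (x + a) (t + b))"
    by (simp add: case_prod_unfold)
  fix x t :: real assume "0 \<le> t"
  then have t: "0 \<le> t + b" using b by simp
  show "((\<lambda>y. v (y + a) (t + b)) has_real_derivative p (x + a) (t + b)) (at x)"
    using dv[OF t, of "x + a"] by (simp add: DERIV_shift)
  show "((\<lambda>y. p (y + a) (t + b)) has_real_derivative q (x + a) (t + b)) (at x)"
    using dp[OF t, of "x + a"] by (simp add: DERIV_shift)
  show "((\<lambda>s. v (x + a) (s + b)) has_real_derivative q (x + a) (t + b) / (1 + (p (x + a) (t + b))\<^sup>2)) (at t)"
    using evolution[OF t, of "x + a"] by (simp add: DERIV_shift)
qed

lemma p_periodic:
  assumes "0 \<le> t" shows "p (x + 1) t = p x t"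
proof -
  have "((\<lambda>y. v (y + 1) t) has_real_derivative p (x + 1) t) (at x)"
    using dv[OF assms, of "x + 1"] by (simp add: DERIV_shift)
  then show ?thesis
    using dv[OF assms, of x] periodic[OF assms] DERIV_unique by simp
qed

end

text \<open>At a spatial maximum of \<open>v1 - v2\<close> the slopes agree, hence so do the
  diffusion coefficients, and the sign of \<open>q1 - q2\<close> alone controls the time
  derivative.\<close>

lemma comparison:
  assumes "graph_flow v1 p1 q1" and "graph_flow v2 p2 q2"
    and init: "\<And>x. v1 x 0 - v2 x 0 \<le> N" and t: "0 \<le> t"
  shows "v1 x t - v2 x t \<le> N"
proof (rule field_le_epsilon)
  fix e :: real assume e: "e > 0"
  interpret f1: graph_flow v1 p1 q1 by fact
  interpret f2: graph_flow v2 p2 q2 by fact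
  \<comment> \<open>The penalty \<open>d * (1 + s)\<close> makes both the initial and the touching
    inequality strict, and equals \<open>e\<close> at time \<open>t\<close>.\<close>
  define d where "d = e / (1 + t)"
  have d: "d > 0" using e t by (simp add: d_def)
  define \<Phi> where "\<Phi> x s = v1 x s - v2 x s - N - d * (1 + s)" for x s
  have per: "\<Phi> (frac y) s = \<Phi> y s" if "0 \<le> s" for y s
    by (rule periodic_1_reduce(2)) (simp add: \<Phi>_def f1.periodic f2.periodic that)
  have "\<Phi> (frac x) t < 0"
  proof (rule first_touching[where S = "{0..1}" and T = t and \<Phi> = \<Phi>])
    have "continuous_on ({0..1} \<times> {0..t}) (\<lambda>z. (\<lambda>(x, t). v1 x t) z - (\<lambda>(x, t). v2 x t) z - N - d * (1 + snd z))"
      by (intro continuous_intros continuous_on_subset[OF f1.cont] continuous_on_subset[OF f2.cont]) auto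
    then show "continuous_on ({0..1} \<times> {0..t}) (\<lambda>(z, t). \<Phi> z t)"
      by (simp add: \<Phi>_def case_prod_unfold)
    show "\<Phi> z 0 < 0" for z
      using init[of z] d by (simp add: \<Phi>_def)
    fix z s assume z: "z \<in> {0..1::real}" and s: "0 < s" "s \<le> t" and 0: "\<Phi> z s = 0"
      and le: "\<forall>y\<in>{0..1}. \<Phi> y s \<le> 0"
    have max: "\<Phi> y s \<le> \<Phi> z s" for y
      using le per[of s y] s 0 by (metis atLeastAtMost_iff frac_ge_0 frac_lt_1 less_imp_le)
    have "p1 z s - p2 z s = 0" "q1 z s - q2 z s \<le> 0"
      by (rule second_derivative_test[of "\<lambda>y. \<Phi> y s" "\<lambda>y. p1 y s - p2 y s" _ _ 1];
          use s max in \<open>auto simp: \<Phi>_def intro!: derivative_eq_intros f1.dv f2.dv f1.dp f2.dp\<close>)+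
    then have "q1 z s / (1 + (p1 z s)\<^sup>2) \<le> q2 z s / (1 + (p2 z s)\<^sup>2)"
      by (auto intro!: divide_right_mono)
    moreover have "(\<Phi> z has_real_derivative q1 z s / (1 + (p1 z s)\<^sup>2) - q2 z s / (1 + (p2 z s)\<^sup>2) - d) (at s)"
      unfolding \<Phi>_def using s by (auto intro!: derivative_eq_intros f1.evolution f2.evolution)
    ultimately show "\<exists>D<0. (\<Phi> z has_real_derivative D) (at s)"
      using d by (intro exI[of _ "q1 z s / (1 + (p1 z s)\<^sup>2) - q2 z s / (1 + (p2 z s)\<^sup>2) - d"]) auto
  qed (use t in \<open>auto intro: less_imp_le frac_lt_1\<close>)
  then have "\<Phi> x t < 0" using per t by simp
  then show "v1 x t - v2 x t \<le> N + e"
    using t by (simp add: \<Phi>_def d_def)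
qed

section \<open>Decay of oscillation by doubling the variables\<close>

text \<open>With \<open>a p = 1 / (1 + p\<^sup>2)\<close>, the time derivative of
  \<open>w = v1 - v2\<close> is \<open>a p1 * (q1 - q2) + (a p1 - a p2) * q2\<close>. Here
  \<open>a p1 \<ge> 1 / (1 + K\<^sup>2)\<close>, and the last term is at most
  \<open>D * \<bar>p1 - p2\<bar>\<close>. A sufficiently concave function of \<open>x - y\<close> is
  therefore a barrier for \<open>w x s - w y s\<close>, with enough left over to let it decay in
  time.\<close>

lemma oscillation_decay:
  assumes "graph_flow v1 p1 q1" and "graph_flow v2 p2 q2"
    and K: "\<And>x t. 0 \<le> t \<Longrightarrow> \<bar>p1 x t\<bar> \<le> K"
    and D: "0 \<le> D" "\<And>x t. 0 \<le> t \<Longrightarrow> \<bar>q2 x t\<bar> \<le> D"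
    and init: "\<And>x y. (v1 x 0 - v2 x 0) - (v1 y 0 - v2 y 0) < N"
    and t: "0 \<le> t"
    and k: "k = (D + 1) * (1 + K\<^sup>2)" and E: "E = cosh k + 1"
  shows "(v1 x t - v2 x t) - (v1 y t - v2 y t) \<le> N * E * exp (- (k / E) * t)"
proof -
  interpret f1: graph_flow v1 p1 q1 by fact
  interpret f2: graph_flow v2 p2 q2 by fact
  have K2: "1 + K\<^sup>2 > 0" by (auto intro: add_pos_nonneg)
  have N: "N > 0" using init[of 0 0] by simp
  have kpos: "k > 0" unfolding k using D K2 by auto
  have Epos: "E > 0" using E cosh_real_pos[of k] by linarith
  define w where "w x s = v1 x s - v2 x s" for x s
  define g where "g s = N * exp (- (k / E) * s)" for s
  have gpos: "g s > 0" for s using N by (simp add: g_def)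
  \<comment> \<open>The choice of \<open>k\<close> gives \<open>2 \<phi>'' / (1 + K\<^sup>2) + 2 D \<bar>\<phi>'\<bar> + (k / E) \<phi> < 0\<close>; moreover \<open>1 \<le> \<phi> \<le> E\<close>
    on \<open>[0, 1]\<close>, so the touching point avoids \<open>r = 0\<close> and \<open>r = 1\<close>, where the difference of \<open>w\<close> is 0.\<close>
  define \<phi> where "\<phi> r = E - cosh (k * (r - 1/2))" for r
  have \<phi>_ge: "\<phi> r \<ge> 1" if "r \<in> {0..1}" for r
  proof -
    have "\<bar>k * (r - 1/2)\<bar> \<le> \<bar>k\<bar>"
      using that kpos mult_left_mono[of "\<bar>r - 1/2\<bar>" 1 k] by (auto simp: abs_mult)
    then have "cosh (k * (r - 1/2)) \<le> cosh k"
      by (metis abs_ge_zero cosh_real_abs cosh_real_nonneg_le_iff)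
    then show ?thesis by (simp add: \<phi>_def E)
  qed
  have \<phi>_le: "\<phi> r \<le> E" for r by (simp add: \<phi>_def less_imp_le)
  have d\<phi>: "(\<phi> has_real_derivative - k * sinh (k * (r - 1/2))) (at r)" for r
    unfolding \<phi>_def by (auto intro!: derivative_eq_intros)
  have w1: "((\<lambda>x. w x s) has_real_derivative p1 x s - p2 x s) (at x)" if "0 \<le> s" for x s
    unfolding w_def using that by (auto intro!: derivative_intros f1.dv f2.dv)
  have w2: "((\<lambda>x. p1 x s - p2 x s) has_real_derivative q1 x s - q2 x s) (at x)" if "0 \<le> s" for x s
    using that by (auto intro!: derivative_intros f1.dp f2.dp)
  have wper: "w (x + 1) s = w x s" if "0 \<le> s" for x s
    using that by (simp add: w_def f1.periodic f2.periodic)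
  have frac01: "frac x \<in> {0..1}" for x :: real by (auto intro: less_imp_le frac_lt_1)
  define \<Phi> where "\<Phi> = (\<lambda>(r, y) s. w (y + r) s - w y s - g s * \<phi> r)"
  have "\<Phi> (frac (x - y), frac y) t < 0"
  proof (rule first_touching[where S = "{0..1} \<times> {0..1}" and T = t and \<Phi> = \<Phi>])
    show "compact ({0..1} \<times> {0..1::real} :: (real \<times> real) set)" by (intro compact_Times compact_Icc)
    have W: "continuous_on (UNIV \<times> {0..}) (\<lambda>(x, t). w x t)"
      using continuous_on_diff[OF f1.cont f2.cont] by (simp add: w_def case_prod_unfold)
    have W1: "continuous_on (({0..1} \<times> {0..1}) \<times> {0..t}) (\<lambda>z :: (real \<times> real) \<times> real. w (snd (fst z) + fst (fst z)) (snd z))"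
    proof -
      have "continuous_on (({0..1} \<times> {0..1}) \<times> {0..t}) (\<lambda>z :: (real \<times> real) \<times> real. case (snd (fst z) + fst (fst z), snd z) of (x, t) \<Rightarrow> w x t)"
        by (rule continuous_on_compose2[OF W]) (auto intro!: continuous_intros)
      then show ?thesis by simp
    qed
    have W2: "continuous_on (({0..1} \<times> {0..1}) \<times> {0..t}) (\<lambda>z :: (real \<times> real) \<times> real. w (snd (fst z)) (snd z))"
    proof -
      have "continuous_on (({0..1} \<times> {0..1}) \<times> {0..t}) (\<lambda>z :: (real \<times> real) \<times> real. case (snd (fst z), snd z) of (x, t) \<Rightarrow> w x t)"
        by (rule continuous_on_compose2[OF W]) (auto intro!: continuous_intros)
      then show ?thesis by simp
    qed
    have "continuous_on UNIV \<phi>"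
      using d\<phi> DERIV_isCont by (blast intro: continuous_at_imp_continuous_on)
    then have W3: "continuous_on (({0..1} \<times> {0..1}) \<times> {0..t}) (\<lambda>z :: (real \<times> real) \<times> real. \<phi> (fst (fst z)))"
      by (rule continuous_on_compose2) (auto intro!: continuous_intros)
    have "continuous_on (({0..1} \<times> {0..1}) \<times> {0..t})
      (\<lambda>z :: (real \<times> real) \<times> real. w (snd (fst z) + fst (fst z)) (snd z) - w (snd (fst z)) (snd z)
        - g (snd z) * \<phi> (fst (fst z)))"
      unfolding g_def by (intro continuous_intros W1 W2 W3)
    then show "continuous_on (({0..1} \<times> {0..1}) \<times> {0..t}) (\<lambda>(z, t). \<Phi> z t)"
      by (simp add: \<Phi>_def case_prod_unfold)
    show "\<Phi> z 0 < 0" if z01: "z \<in> {0..1} \<times> {0..1}" for z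
    proof -
      obtain r y where z: "z = (r, y)" "r \<in> {0..1}" using z01 by (cases z) auto
      have "N * 1 \<le> g 0 * \<phi> r" unfolding g_def using \<phi>_ge[OF z(2)] N by (intro mult_mono) auto
      then show ?thesis using init[of "y + r" y] by (simp add: \<Phi>_def z w_def)
    qed
    fix z s assume z: "z \<in> {0..1} \<times> {0..1::real}" and s: "0 < s" "s \<le> t" and 0: "\<Phi> z s = 0"
      and le: "\<forall>y\<in>{0..1} \<times> {0..1}. \<Phi> y s \<le> 0"
    obtain r y where ry: "z = (r, y)" "r \<in> {0..1}" "y \<in> {0..1}" using z by (cases z) auto
    define x where "x = y + r"
    have s0: "0 \<le> s" using s by simp
    have touch: "w x s - w y s - g s * \<phi> r = 0" using 0 by (simp add: \<Phi>_def ry x_def)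
    have "w x s - w y s \<noteq> 0" using touch gpos[of s] \<phi>_ge[OF ry(2)] by auto
    then have "r \<noteq> 0" "r \<noteq> 1" using wper[OF s0] by (auto simp: x_def)
    then have r: "0 < r" "r < 1" using ry by auto
    \<comment> \<open>The touching condition only covers \<open>(r, y)\<close> in the unit square,
      and \<open>frac\<close> sends a difference of 1 to 0. That case is settled directly:
      \<open>w\<close> has period 1 and the barrier is positive.\<close>
    have max: "w x' s - w y' s - g s * \<phi> (x' - y') \<le> 0" if "0 \<le> x' - y'" "x' - y' \<le> 1" for x' y'
    proof (cases "x' - y' = 1")
      case True
      then have "w x' s = w y' s" using wper[OF s0, of y'] by (simp add: algebra_simps)
      then show ?thesis using gpos[of s] \<phi>_ge[of "x' - y'"] that by simp
    next
      case False
      then have "frac (x' - y') = x' - y'" using that by (simp add: frac_eq)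
      moreover have "w (frac y' + frac (x' - y')) s = w x' s" "w (frac y') s = w y' s"
        using periodic_1_reduce[of "\<lambda>x. w x s" y'] wper[OF s0] by simp_all
      ultimately show ?thesis
        using bspec[OF le, of "(frac (x' - y'), frac y')"] frac01 that by (simp add: \<Phi>_def)
    qed
    \<comment> \<open>Moving either \<open>x\<close> or \<open>y\<close> by less than this keeps
      their difference in \<open>[0, 1]\<close>.\<close>
    define e where "e = min r (1 - r)"
    have e: "e > 0" using r by (simp add: e_def)
    define A where "A = k * (r - 1/2)"
    define G where "G = g s * (- k * sinh A)"
    define H where "H = g s * (- k * k * cosh A)"
    \<comment> \<open>The maximum is tested in \<open>x\<close> alone here and in \<open>y\<close>
      alone below. Both tests give the same slope \<open>G\<close>, and each supplies one copy of
      the negative \<open>H\<close>.\<close>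
    have X: "p1 x s - p2 x s - G = 0 \<and> q1 x s - q2 x s - H \<le> 0"
    proof -
      let ?f = "\<lambda>x'. w x' s - w y s - g s * \<phi> (x' - y)"
      let ?f' = "\<lambda>x'. p1 x' s - p2 x' s - g s * (- k * sinh (k * (x' - y - 1/2)))"
      have f: "(?f has_real_derivative ?f' x') (at x')" for x'
        using s0 by (auto intro!: derivative_eq_intros w1 DERIV_chain2[OF d\<phi>])
      have "(?f' has_real_derivative q1 x s - q2 x s - g s * (- k * k * cosh (k * (x - y - 1/2)))) (at x)"
        using s0 by (auto intro!: derivative_eq_intros w2[THEN DERIV_cong])
      then have f': "(?f' has_real_derivative q1 x s - q2 x s - H) (at x)"
        by (simp add: H_def A_def x_def)
      have "?f x' \<le> ?f x" if "\<bar>x' - x\<bar> < e" for x'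
        using max[of x' y] touch that by (auto simp: e_def x_def)
      from second_derivative_test[OF f f' e this] show ?thesis
        by (simp add: G_def A_def x_def)
    qed
    have Y: "G - (p1 y s - p2 y s) = 0 \<and> - (q1 y s - q2 y s) - H \<le> 0"
    proof -
      let ?f = "\<lambda>y'. w x s - w y' s - g s * \<phi> (x - y')"
      let ?f' = "\<lambda>y'. g s * (- k * sinh (k * (x - y' - 1/2))) - (p1 y' s - p2 y' s)"
      have f: "(?f has_real_derivative ?f' y') (at y')" for y'
        using s0 by (auto intro!: derivative_eq_intros w1 DERIV_chain2[OF d\<phi>])
      have "(?f' has_real_derivative g s * (k * k * cosh (k * (x - y - 1/2))) - (q1 y s - q2 y s)) (at y)"
        using s0 by (auto intro!: derivative_eq_intros w2[THEN DERIV_cong])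
      then have f': "(?f' has_real_derivative - (q1 y s - q2 y s) - H) (at y)"
        by (rule DERIV_cong) (simp add: H_def A_def x_def)
      have "?f y' \<le> ?f y" if "\<bar>y' - y\<bar> < e" for y'
        using max[of x y'] touch that by (auto simp: e_def x_def)
      from second_derivative_test[OF f f' e this] show ?thesis
        by (simp add: G_def A_def x_def)
    qed
    define R where "R \<xi> = q1 \<xi> s / (1 + (p1 \<xi> s)\<^sup>2) - q2 \<xi> s / (1 + (p2 \<xi> s)\<^sup>2)" for \<xi>
    have H: "H < 0" using gpos[of s] kpos cosh_real_pos[of A] by (simp add: H_def)
    have a: "1 / (1 + (p1 \<xi> s)\<^sup>2) * H \<le> 1 / (1 + K\<^sup>2) * H" for \<xi>
    proof (rule mult_right_mono_neg)
      have "(p1 \<xi> s)\<^sup>2 \<le> K\<^sup>2" using K[OF s0, of \<xi>] by (metis abs_ge_zero power2_abs power_mono)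
      then show "1 / (1 + K\<^sup>2) \<le> 1 / (1 + (p1 \<xi> s)\<^sup>2)"
        by (intro divide_left_mono) (auto intro!: mult_pos_pos add_pos_nonneg)
    qed (use H in simp)
    have c: "\<bar>(1 / (1 + (p1 \<xi> s)\<^sup>2) - 1 / (1 + (p2 \<xi> s)\<^sup>2)) * q2 \<xi> s\<bar> \<le> \<bar>G\<bar> * D"
      if "p1 \<xi> s - p2 \<xi> s = G" for \<xi>
      unfolding abs_mult
      using abs_diff_inverse_one_plus_square_le[of "p1 \<xi> s" "p2 \<xi> s"] that D s0 by (intro mult_mono) auto
    have R: "R \<xi> = 1 / (1 + (p1 \<xi> s)\<^sup>2) * (q1 \<xi> s - q2 \<xi> s)
        + (1 / (1 + (p1 \<xi> s)\<^sup>2) - 1 / (1 + (p2 \<xi> s)\<^sup>2)) * q2 \<xi> s" for \<xi>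
      by (simp add: R_def algebra_simps diff_divide_distrib)
    \<comment> \<open>The closing arithmetic with all products as atoms: diffusion at the two ends
      gives \<open>- 2 * e\<close>, and the time derivative of the barrier costs at most
      \<open>d \<le> e\<close>.\<close>
    have sum_neg: "a + b < 0" if "a \<le> - 2 * e" "d * 1 \<le> e" "b \<le> f" "0 < d" "f = d"
      for a b d e f :: real
      using that by simp
    have "1 / (1 + (p1 x s)\<^sup>2) * (q1 x s - q2 x s) \<le> 1 / (1 + (p1 x s)\<^sup>2) * H"
      using X by (intro mult_left_mono) auto
    then have Rx: "R x \<le> 1 / (1 + K\<^sup>2) * H + \<bar>G\<bar> * D"
      using R[of x] a[of x] c[of x] X by linarith
    have "1 / (1 + (p1 y s)\<^sup>2) * - (q1 y s - q2 y s) \<le> 1 / (1 + (p1 y s)\<^sup>2) * H"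
      using Y by (intro mult_left_mono) auto
    then have Ry: "- R y \<le> 1 / (1 + K\<^sup>2) * H + \<bar>G\<bar> * D"
      using R[of y] a[of y] c[of y] Y unfolding mult_minus_right by linarith
    \<comment> \<open>The factor \<open>1 + K\<^sup>2\<close> in \<open>k\<close> cancels the
      ellipticity constant. Of the remaining \<open>D + 1\<close>, the \<open>D\<close> absorbs the
      gradient term because \<open>\<bar>sinh A\<bar> \<le> cosh A\<close>, and the \<open>1\<close>
      survives at each end.\<close>
    have "(D + 1) * (1 + K\<^sup>2) / (1 + K\<^sup>2) = D + 1" using K2 by simp
    then have "1 / (1 + K\<^sup>2) * H = - (g s * k * cosh A) * (D + 1)"
      unfolding H_def by (simp add: k)
    moreover have "\<bar>G\<bar> * D \<le> g s * k * cosh A * D"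
    proof (rule mult_right_mono)
      have "\<bar>sinh A\<bar> \<le> cosh A"
        by (metis cosh_real_abs sinh_real_abs sinh_le_cosh_real)
      then show "\<bar>G\<bar> \<le> g s * k * cosh A"
        using gpos[of s] kpos by (simp add: G_def abs_mult)
    qed fact
    ultimately have "R x - R y \<le> - 2 * (g s * k * cosh A)"
      using Rx Ry by (simp add: algebra_simps)
    moreover have "g s * k * 1 \<le> g s * k * cosh A"
      using gpos[of s] kpos cosh_real_ge_1[of A] by (intro mult_left_mono) auto
    \<comment> \<open>Since \<open>\<phi> \<le> E\<close>, the rate \<open>k / E\<close> makes the
      decay of \<open>g\<close> cost at most \<open>g s * k\<close>, half of what the two ends
      supply.\<close>
    moreover have "k / E * g s * \<phi> r \<le> k / E * g s * E"
      using kpos Epos gpos[of s] \<phi>_le[of r] by (intro mult_left_mono) auto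
    moreover have "g s * k > 0" using gpos[of s] kpos by simp
    moreover have "k / E * g s * E = g s * k" using Epos by simp
    ultimately have neg: "R x - R y + k / E * g s * \<phi> r < 0" by (rule sum_neg)
    have "((\<lambda>s. w x s - w y s - g s * \<phi> r) has_real_derivative R x - R y + k / E * g s * \<phi> r) (at s)"
      unfolding w_def g_def R_def using s0 Epos
      by (auto intro!: derivative_eq_intros f1.evolution f2.evolution)
    then have "(\<Phi> z has_real_derivative R x - R y + k / E * g s * \<phi> r) (at s)"
      by (simp add: \<Phi>_def ry x_def)
    then show "\<exists>D<0. (\<Phi> z has_real_derivative D) (at s)"
      using neg by blast
  qed (use t frac01 in auto)
  moreover have "w (frac y + frac (x - y)) t = w x t" "w (frac y) t = w y t"
    using periodic_1_reduce[of "\<lambda>x. w x t" y] wper[OF t] by simp_all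
  ultimately have "w x t - w y t \<le> g t * \<phi> (frac (x - y))" by (simp add: \<Phi>_def)
  also have "\<dots> \<le> g t * E" using gpos[of t] \<phi>_le by (intro mult_left_mono) auto
  finally show ?thesis by (simp add: w_def g_def mult.commute mult.left_commute)
qed

section \<open>Difference quotients, increments and limits\<close>

text \<open>This turns the comparison of a flow with its translate by \<open>h\<close> into a bound
  on a derivative, without differentiating the equation. Increments to the right suffice, as the
  derivative is known to exist.\<close>

lemma abs_derivative_le:
  fixes f :: "real \<Rightarrow> real"
  assumes f: "(f has_real_derivative D) (at x)"
    and le: "\<And>h. 0 < h \<Longrightarrow> h < 1 \<Longrightarrow> \<bar>f (x + h) - f x\<bar> \<le> C * h"
  shows "\<bar>D\<bar> \<le> C"
proof (rule tendsto_upperbound)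
  have "((\<lambda>h. (f (x + h) - f x) / h) \<longlongrightarrow> D) (at_right 0)"
    using f by (auto simp: DERIV_def intro: tendsto_mono[OF at_le])
  then show "((\<lambda>h. \<bar>(f (x + h) - f x) / h\<bar>) \<longlongrightarrow> \<bar>D\<bar>) (at_right 0)"
    by (rule tendsto_rabs)
  have "\<bar>(f (x + h) - f x) / h\<bar> \<le> C" if "0 < h" "h < 1" for h
    using le[OF that] that by (simp add: abs_divide divide_le_eq)
  then show "\<forall>\<^sub>F h in at_right 0. \<bar>(f (x + h) - f x) / h\<bar> \<le> C"
    by (auto simp: eventually_at_right_field intro!: exI[of _ 1])
qed simp

lemma abs_increment_le:
  fixes f :: "real \<Rightarrow> real"
  assumes "\<And>y. a \<le> y \<Longrightarrow> y \<le> b \<Longrightarrow> (f has_real_derivative f' y) (at y)"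
    and "\<And>y. a \<le> y \<Longrightarrow> y \<le> b \<Longrightarrow> \<bar>f' y\<bar> \<le> C" and "a \<le> b"
  shows "\<bar>f b - f a\<bar> \<le> C * (b - a)"
proof (cases "a = b")
  case False
  then obtain z where z: "a < z" "z < b" "f b - f a = (b - a) * f' z"
    using MVT2[of a b f f'] assms by force
  then have "\<bar>f b - f a\<bar> = \<bar>f' z\<bar> * (b - a)" by (simp add: abs_mult)
  also have "\<dots> \<le> C * (b - a)" using assms z by (intro mult_right_mono) auto
  finally show ?thesis .
qed simp

lemma periodic_derivative_vanishes:
  fixes f :: "real \<Rightarrow> real"
  assumes "\<And>y. (f has_real_derivative f' y) (at y)" and "f (x + 1) = f x"
  obtains \<xi> where "x < \<xi>" "\<xi> < x + 1" "f' \<xi> = 0"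
  using MVT2[of x "x + 1" f f'] assms by auto

text \<open>Let \<open>g\<close> be the tail integral of the bound. Then \<open>f - g\<close> is
  nondecreasing and \<open>f + g\<close> nonincreasing, so every value of the first lies below every
  value of the second, and \<open>L\<close> separates them.\<close>

lemma exp_decaying_derivative_limit:
  fixes f :: "real \<Rightarrow> real"
  assumes f: "\<And>t. 0 \<le> t \<Longrightarrow> (f has_real_derivative f' t) (at t)"
    and b: "\<And>t. 0 \<le> t \<Longrightarrow> \<bar>f' t\<bar> \<le> B * exp (- r * t)" and r: "r > 0"
  obtains L where "\<And>t. 0 \<le> t \<Longrightarrow> \<bar>f t - L\<bar> \<le> B / r * exp (- r * t)"
proof -
  define g where "g t = B / r * exp (- r * t)" for t
  have g: "(g has_real_derivative - B * exp (- r * t)) (at t)" for t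
    unfolding g_def using r by (auto intro!: derivative_eq_intros)
  have lower: "f s - g s \<le> f t - g t" if "0 \<le> s" "s \<le> t" for s t
  proof (rule DERIV_nonneg_imp_nondecreasing[OF that(2)])
    fix y assume "s \<le> y" "y \<le> t"
    then show "\<exists>z. ((\<lambda>t. f t - g t) has_real_derivative z) (at y) \<and> 0 \<le> z"
      using that b[of y] by (intro exI[of _ "f' y + B * exp (- r * y)"]) (auto intro!: derivative_eq_intros f g)
  qed
  have upper: "f t + g t \<le> f s + g s" if "0 \<le> s" "s \<le> t" for s t
  proof (rule DERIV_nonpos_imp_nonincreasing[OF that(2)])
    fix y assume "s \<le> y" "y \<le> t"
    then show "\<exists>z. ((\<lambda>t. f t + g t) has_real_derivative z) (at y) \<and> z \<le> 0"
      using that b[of y] by (intro exI[of _ "f' y - B * exp (- r * y)"]) (auto intro!: derivative_eq_intros f g)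
  qed
  have "B \<ge> 0" using b[of 0] by simp
  then have g0: "g t \<ge> 0" for t using r by (simp add: g_def)
  have le: "f s - g s \<le> f t + g t" if "0 \<le> s" "0 \<le> t" for s t
    using lower[of s "max s t"] upper[of t "max s t"] g0[of "max s t"] that by linarith
  define L where "L = (SUP s\<in>{0..}. f s - g s)"
  have "f t - g t \<le> L" "L \<le> f t + g t" if "0 \<le> t" for t
    unfolding L_def using le that by (auto intro!: cSUP_upper cSUP_least bdd_aboveI2)
  then have "\<bar>f t - L\<bar> \<le> g t" if "0 \<le> t" for t
    using that by (force simp: abs_le_iff algebra_simps)
  then show thesis using that unfolding g_def by blast
qed

section \<open>Exponential decay for the autonomous flow\<close>

text \<open>Comparison with translates propagates the initial bounds to all times. A time translate
  by \<open>h < 1\<close> differs from \<open>v\<close> initially by an increment over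
  \<open>[0, h]\<close>, which is why \<open>R\<close> bounds the speed on
  \<open>[0, 1]\<close>.\<close>

lemma (in graph_flow) exponential_decay:
  assumes K: "\<And>x. \<bar>p x 0\<bar> \<le> K"
    and R: "\<And>x t. 0 \<le> t \<Longrightarrow> t \<le> 1 \<Longrightarrow> \<bar>q x t / (1 + (p x t)\<^sup>2)\<bar> \<le> R"
  obtains B r L where "B > 0" "r > 0"
    "\<And>x t. 0 \<le> t \<Longrightarrow> \<bar>v x t - L\<bar> \<le> B * exp (- r * t)"
    "\<And>x t. 0 \<le> t \<Longrightarrow> \<bar>p x t\<bar> \<le> B * exp (- r * t)"
    "\<And>x t. 0 \<le> t \<Longrightarrow> \<bar>q x t\<bar> \<le> B * exp (- r * t)"
proof -
  define V where "V x t = q x t / (1 + (p x t)\<^sup>2)" for x t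
  have R0: "R \<ge> 0" using order_trans[OF abs_ge_zero R[of 0 0]] by simp
  have self: "graph_flow v p q" by unfold_locales
  have pK: "\<bar>p x t\<bar> \<le> K" if t: "0 \<le> t" for x t
  proof (rule abs_derivative_le[OF dv[OF t]])
    fix h :: real assume h: "0 < h"
    have init: "\<bar>v (y + h) 0 - v y 0\<bar> \<le> K * h" for y
      using abs_increment_le[of y "y + h" "\<lambda>y. v y 0" "\<lambda>y. p y 0" K] dv K h by simp
    have "v (x + h) (t + 0) - v x t \<le> K * h" "v x t - v (x + h) (t + 0) \<le> K * h"
      by (rule comparison[OF translate[of 0 h] self _ t] comparison[OF self translate[of 0 h] _ t];
          use init in \<open>simp add: abs_le_iff\<close>)+
    then show "\<bar>v (x + h) t - v x t\<bar> \<le> K * h" by simp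
  qed
  have increment: "\<bar>v y h - v y 0\<bar> \<le> R * h" if "0 < h" "h < 1" for y h
    using abs_increment_le[of 0 h "v y" "V y" R] evolution R that by (auto simp: V_def)
  have VR: "\<bar>V x t\<bar> \<le> R" if t: "0 \<le> t" for x t
  proof (rule abs_derivative_le[of "v x"])
    fix h :: real assume h: "0 < h" "h < 1"
    have "v (x + 0) (t + h) - v x t \<le> R * h" "v x t - v (x + 0) (t + h) \<le> R * h"
      by (rule comparison[OF translate[of h 0] self _ t] comparison[OF self translate[of h 0] _ t];
          use increment[OF h] h in \<open>simp add: abs_le_iff\<close>)+
    then show "\<bar>v x (t + h) - v x t\<bar> \<le> R * h" by simp
  qed (use evolution t in \<open>simp add: V_def\<close>)
  have qV: "\<bar>q x t\<bar> \<le> (1 + K\<^sup>2) * \<bar>V x t\<bar>" if t: "0 \<le> t" for x t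
  proof -
    have pos: "1 + (p x t)\<^sup>2 > 0" by (auto intro: add_pos_nonneg)
    have "(p x t)\<^sup>2 \<le> K\<^sup>2" using pK[OF t, of x] by (metis abs_ge_zero power2_abs power_mono)
    then have "(1 + (p x t)\<^sup>2) * \<bar>V x t\<bar> \<le> (1 + K\<^sup>2) * \<bar>V x t\<bar>" by (intro mult_right_mono) auto
    then show ?thesis using pos by (simp add: V_def abs_divide)
  qed
  define D where "D = (1 + K\<^sup>2) * R"
  have D0: "0 \<le> D" using R0 by (simp add: D_def)
  have qD: "\<bar>q x t\<bar> \<le> D" if t: "0 \<le> t" for x t
    using qV[OF t, of x] VR[OF t, of x] mult_left_mono[of "\<bar>V x t\<bar>" R "1 + K\<^sup>2"] by (simp add: D_def)
  define k where "k = (D + 1) * (1 + K\<^sup>2)"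
  define E where "E = cosh k + 1"
  define r where "r = k / E"
  define B0 where "B0 = (2 * R + 1) * E"
  have K2: "1 + K\<^sup>2 \<ge> 1" by simp
  have "k > 0" unfolding k_def using D0 by (intro mult_pos_pos add_nonneg_pos add_pos_nonneg) auto
  moreover have "E > 1" unfolding E_def using cosh_real_pos[of k] by linarith
  ultimately have r: "r > 0" and B0: "B0 > 0" using R0 by (auto simp: r_def B0_def)
  have oscV: "\<bar>V x t - V y t\<bar> \<le> B0 * exp (- r * t)" if t: "0 \<le> t" for x y t
  proof (rule abs_derivative_le[of "\<lambda>s. v x s - v y s"])
    show "((\<lambda>s. v x s - v y s) has_real_derivative V x t - V y t) (at t)"
      unfolding V_def using t by (intro derivative_intros evolution)
    fix h :: real assume h: "0 < h" "h < 1"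
    \<comment> \<open>Two increments of size at most \<open>R * h\<close> give
      \<open>2 * R * h\<close>. The extra \<open>h\<close> makes the inequality strict and keeps the
      bound linear in \<open>h\<close>, as the passage to the derivative demands.\<close>
    have init: "(v (x + 0) (0 + h) - v x 0) - (v (y + 0) (0 + h) - v y 0) < (2 * R + 1) * h" for x y
      using increment[OF h, of x] increment[OF h, of y] h by (simp add: abs_le_iff algebra_simps)
    have "(v (x + 0) (t + h) - v x t) - (v (y + 0) (t + h) - v y t) \<le> (2 * R + 1) * h * E * exp (- (k / E) * t)" for x y
      by (rule oscillation_decay[OF translate[of h 0] self _ D0 qD init t k_def E_def]) (use h pK in auto)
    from this[of x y] this[of y x]
    show "\<bar>v x (t + h) - v y (t + h) - (v x t - v y t)\<bar> \<le> B0 * exp (- r * t) * h"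
      by (simp add: B0_def r_def abs_le_iff algebra_simps)
  qed
  have Vb: "\<bar>V x t\<bar> \<le> B0 * exp (- r * t)" if t: "0 \<le> t" for x t
  proof -
    obtain \<xi> where "q \<xi> t = 0"
      using periodic_derivative_vanishes[of "\<lambda>x. p x t" "\<lambda>x. q x t" 0] dp[OF t] p_periodic[OF t] by metis
    then show ?thesis using oscV[OF t, of x \<xi>] by (simp add: V_def)
  qed
  define B1 where "B1 = (1 + K\<^sup>2) * B0"
  have B1: "B1 > 0" unfolding B1_def using B0 K2 by (intro mult_pos_pos) linarith+
  have qb: "\<bar>q x t\<bar> \<le> B1 * exp (- r * t)" if t: "0 \<le> t" for x t
    using qV[OF t, of x] mult_left_mono[OF Vb[OF t, of x], of "1 + K\<^sup>2"] by (simp add: B1_def mult.assoc)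
  have pb: "\<bar>p x t\<bar> \<le> B1 * exp (- r * t)" if t: "0 \<le> t" for x t
  proof -
    obtain \<xi> where \<xi>: "x < \<xi>" "\<xi> < x + 1" "p \<xi> t = 0"
      using periodic_derivative_vanishes[of "\<lambda>x. v x t" "\<lambda>x. p x t" x] dv[OF t] periodic[OF t] by metis
    have "\<bar>p \<xi> t - p x t\<bar> \<le> B1 * exp (- r * t) * (\<xi> - x)"
      using abs_increment_le[of x \<xi> "\<lambda>x. p x t" "\<lambda>x. q x t"] dp[OF t] qb[OF t] \<xi> by simp
    also have "\<dots> \<le> B1 * exp (- r * t) * 1" using \<xi> B1 by (intro mult_left_mono) auto
    finally show ?thesis using \<xi> by simp
  qed
  obtain L where L: "\<And>t. 0 \<le> t \<Longrightarrow> \<bar>v 0 t - L\<bar> \<le> B0 / r * exp (- r * t)"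
    using exp_decaying_derivative_limit[of "v 0" "V 0" B0 r] evolution Vb r unfolding V_def by blast
  have vb: "\<bar>v x t - L\<bar> \<le> (B1 + B0 / r) * exp (- r * t)" if t: "0 \<le> t" for x t
  proof -
    have "\<bar>v (frac x) t - v 0 t\<bar> \<le> B1 * exp (- r * t) * (frac x - 0)"
      using abs_increment_le[of 0 "frac x" "\<lambda>x. v x t" "\<lambda>x. p x t"] dv[OF t] pb[OF t] by simp
    also have "\<dots> \<le> B1 * exp (- r * t) * 1" using frac_lt_1[of x] B1 by (intro mult_left_mono) auto
    finally have "\<bar>v x t - v 0 t\<bar> \<le> B1 * exp (- r * t)"
      using periodic_1_reduce(2)[of "\<lambda>x. v x t" x] periodic[OF t] by simp
    then show ?thesis using L[OF t] by (simp add: algebra_simps)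
  qed
  have "B0 / r > 0" using B0 r by simp
  show thesis
  proof (rule that[of "B1 + B0 / r" r L])
    have "B1 * exp (- r * t) \<le> (B1 + B0 / r) * exp (- r * t)" for t
      using \<open>B0 / r > 0\<close> by (intro mult_right_mono) auto
    then show "\<bar>p x t\<bar> \<le> (B1 + B0 / r) * exp (- r * t)" "\<bar>q x t\<bar> \<le> (B1 + B0 / r) * exp (- r * t)"
      if "0 \<le> t" for x t
      using pb[OF that] qb[OF that] order_trans by blast+
  qed (use B1 r \<open>B0 / r > 0\<close> vb in auto)
qed

section \<open>Change of time and curvature of a graph\<close>

text \<open>\<open>M\<close> is the antiderivative of \<open>m\<close> vanishing at
  \<open>t0\<close>, and \<open>T\<close> is its inverse. The lower bound \<open>c\<close> makes
  \<open>M\<close> onto and \<open>T\<close> Lipschitz, so the inverse function rule applies.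
  Working on all reals gives \<open>T\<close> a two-sided derivative at 0.\<close>

lemma time_change:
  fixes m :: "real \<Rightarrow> real"
  assumes cont: "\<And>t. isCont m t" and ge: "\<And>t. c \<le> m t" and c: "c > 0"
  obtains M T where "\<And>t. T (M t) = t" "T 0 = t0"
    "\<And>t. t0 \<le> t \<Longrightarrow> c * (t - t0) \<le> M t"
    "\<And>s. 0 \<le> s \<Longrightarrow> t0 \<le> T s" "\<And>s. 0 \<le> s \<Longrightarrow> T s \<le> t0 + s / c"
    "\<And>s. (T has_real_derivative 1 / m (T s)) (at s)"
proof -
  obtain F where F: "\<And>t. (F has_real_derivative m t) (at t)"
    using einterval_antiderivative[of "-\<infinity>" \<infinity> m] cont
    by (auto simp: has_real_derivative_iff_has_vector_derivative)
  define M where "M t = F t - F t0" for t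
  have M: "(M has_real_derivative m t) (at t)" for t
    unfolding M_def by (auto intro!: derivative_eq_intros F)
  have incr: "c * (t - s) \<le> M t - M s" if st: "s \<le> t" for s t
  proof (cases "s = t")
    case False
    then obtain z where z: "M t - M s = (t - s) * m z" using MVT2[of s t M m] M st by auto
    then show ?thesis using mult_right_mono[OF ge[of z], of "t - s"] st by (simp add: mult.commute)
  qed simp
  have "\<exists>t. M t = s" for s
  proof -
    have "c * (\<bar>s\<bar> / c) \<le> M (t0 + \<bar>s\<bar> / c) - M t0" "c * (\<bar>s\<bar> / c) \<le> M t0 - M (t0 - \<bar>s\<bar> / c)"
      using incr[of t0 "t0 + \<bar>s\<bar> / c"] incr[of "t0 - \<bar>s\<bar> / c" t0] c by simp_all
    then have "M (t0 - \<bar>s\<bar> / c) \<le> s" "s \<le> M (t0 + \<bar>s\<bar> / c)" "t0 - \<bar>s\<bar> / c \<le> t0 + \<bar>s\<bar> / c"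
      using c by (simp_all add: M_def)
    then show ?thesis
      using IVT[of M "t0 - \<bar>s\<bar> / c" s "t0 + \<bar>s\<bar> / c"] M DERIV_isCont by blast
  qed
  then obtain T where MT: "\<And>s. M (T s) = s" by metis
  have M0: "M t0 = 0" by (simp add: M_def)
  have lip: "c * \<bar>t - s\<bar> \<le> \<bar>M t - M s\<bar>" for s t
    using incr[of s t] incr[of t s] by (cases "s \<le> t") (auto simp: algebra_simps)
  have inj: "s = t" if "M s = M t" for s t
    using lip[of t s] that c by (auto simp: mult_le_0_iff)
  then have TM: "T (M t) = t" for t using MT by blast
  have "(1 / c)-lipschitz_on UNIV T"
    using lip[of "T _" "T _"] c by (intro lipschitz_onI) (auto simp: MT dist_real_def field_simps)
  then have "continuous_on UNIV T" by (rule lipschitz_on_continuous_on)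
  then have contT: "isCont T s" for s by (simp add: continuous_on_eq_continuous_at)
  have dT: "(T has_real_derivative 1 / m (T s)) (at s)" for s
    using DERIV_inverse_function[where f = M and g = T and x = s and D = "m (T s)" and a = "s - 1" and b = "s + 1"] M contT ge[of "T s"] c MT
    by (auto simp: inverse_eq_divide)
  have ge0: "t0 \<le> T s" if s: "0 \<le> s" for s
  proof (rule ccontr)
    assume "\<not> t0 \<le> T s"
    then have "0 < c * (t0 - T s)" "c * (t0 - T s) \<le> M t0 - M (T s)" using incr[of "T s" t0] c by auto
    then show False using s M0 MT by simp
  qed
  have "T s \<le> t0 + s / c" if s: "0 \<le> s" for s
    using incr[OF ge0[OF s]] M0 MT[of s] c by (simp add: field_simps)
  then show thesis
    using that[where M = M and T = T] TM M0 incr[of t0] ge0 dT by (metis diff_0_right)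
qed

text \<open>Applied to the slope, this is the usual curvature formula for a graph, which turns the
  geometric equation into a quasilinear one.\<close>

lemma has_real_derivative_div_sqrt_one_plus_square:
  assumes "(f has_real_derivative f') (at x)"
  shows "((\<lambda>y. f y / sqrt (1 + (f y)\<^sup>2)) has_real_derivative
    f' / ((1 + (f x)\<^sup>2) * sqrt (1 + (f x)\<^sup>2))) (at x)"
proof -
  have pos: "1 + (f x)\<^sup>2 > 0" by (auto intro: add_pos_nonneg)
  define S where "S = sqrt (1 + (f x)\<^sup>2)"
  have S: "S > 0" "1 + (f x)\<^sup>2 = S * S" using pos by (simp_all add: S_def)
  have "((\<lambda>y. f y / sqrt (1 + (f y)\<^sup>2)) has_real_derivative
    (f' * S - f x * (2 * f x * f' / (2 * S))) / (S * S)) (at x)"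
    using pos unfolding S_def
    by (auto intro!: derivative_eq_intros assms simp: field_simps)
  moreover have "f' * S - f x * (2 * f x * f' / (2 * S)) = f' * (S * S - (f x)\<^sup>2) / S"
    using S by (simp add: field_simps power2_eq_square)
  moreover have "S * S - (f x)\<^sup>2 = 1" using S by simp
  ultimately show ?thesis using S by (simp add: S_def[symmetric] mult.commute)
qed

lemma abs_sup_norm_le:
  assumes "\<And>x. \<bar>f x\<bar> \<le> b"
  shows "\<bar>sup_norm f\<bar> \<le> b"
proof -
  have "\<bar>f 0\<bar> \<le> sup_norm f"
    unfolding sup_norm_def using assms by (intro cSUP_upper bdd_aboveI2[of _ _ b]) auto
  moreover have "sup_norm f \<le> b"
    unfolding sup_norm_def using assms by (intro cSUP_least) auto
  ultimately show ?thesis by simp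
qed

section \<open>Reduction of the system to the autonomous flow\<close>

theorem theorem5p1:
  fixes \<mu> \<gamma> \<alpha>0 \<beta> :: real
    and u0 \<sigma> \<alpha> :: "real \<Rightarrow> real"
    and u :: "real \<Rightarrow> real \<Rightarrow> real"
  assumes "\<mu> > 0" and "\<gamma> > 0" and "0 < \<beta>" and "\<beta> < 1"
    and "periodic1 u0" and "\<exists>K. K-lipschitz_on UNIV u0"
    and "\<sigma> C1_differentiable_on UNIV"
    and "\<exists>C1>0. \<forall>a. \<sigma> a \<ge> C1"
    and "\<forall>a. a * deriv \<sigma> a \<ge> 0"
    and "\<exists>L>0. \<forall>a b. \<bar>deriv \<sigma> a - deriv \<sigma> b\<bar> \<le> L * \<bar>a - b\<bar>"
    and "global_solution \<beta> \<mu> \<gamma> \<sigma> u0 \<alpha>0 u \<alpha>"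
  shows "(\<exists>u_inf :: real. exponentially_to_0 (\<lambda>t. C2_norm (\<lambda>x. u x t - u_inf))) \<and>
         exponentially_to_0 (\<lambda>t. sup_norm (\<lambda>x. curvature u x t))"
proof -
  note sol = \<open>global_solution \<beta> \<mu> \<gamma> \<sigma> u0 \<alpha>0 u \<alpha>\<close>
  have reg: "continuous_on (UNIV \<times> {0..T}) (\<lambda>(x, t). u x t)"
    "parabolic_C2_on \<beta> (UNIV \<times> {e<..<T}) u" "continuous_on {0..<T} \<alpha>" if "0 < e" "e < T" for e T
    using sol that unfolding global_solution_def by blast+
  have per: "u (x + 1) t = u x t" if "0 \<le> t" for x t
    using sol that unfolding global_solution_def periodic1_def by blast
  obtain C1 where C1: "C1 > 0" "\<And>a. C1 \<le> \<sigma> a" using assms by blast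
  define c where "c = \<mu> * C1"
  have c: "c > 0" using C1 \<open>\<mu> > 0\<close> by (simp add: c_def)

  have dux: "((\<lambda>y. u y t) has_real_derivative dx u x t) (at x)"
    and duxx: "((\<lambda>y. dx u y t) has_real_derivative dx (dx u) x t) (at x)"
    and dut: "((\<lambda>s. u x s) has_real_derivative dt u x t) (at t)" if "0 < t" for x t
  proof -
    have "(\<lambda>y. u y t) differentiable (at x)" "(\<lambda>y. dx u y t) differentiable (at x)"
      "(\<lambda>s. u x s) differentiable (at t)"
      using reg(2)[of "t/2" "t + 1"] that unfolding parabolic_C2_on_def by auto
    then show "((\<lambda>y. u y t) has_real_derivative dx u x t) (at x)"
      "((\<lambda>y. dx u y t) has_real_derivative dx (dx u) x t) (at x)"
      "((\<lambda>s. u x s) has_real_derivative dt u x t) (at t)"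
      unfolding dx_def[of u x t] dx_def[of "dx u"] dt_def by (simp_all add: DERIV_deriv_iff_real_differentiable)
  qed
  have curv: "curvature u x t = dx (dx u) x t / ((1 + (dx u x t)\<^sup>2) * sqrt (1 + (dx u x t)\<^sup>2))" if "0 < t" for x t
    unfolding curvature_def dx_def[of "\<lambda>x t. dx u x t / sqrt (1 + (dx u x t)\<^sup>2)"]
    by (rule DERIV_imp_deriv[OF has_real_derivative_div_sqrt_one_plus_square[OF duxx[OF that]]])
  have pde: "dt u x t = \<mu> * \<sigma> (\<alpha> t) * (dx (dx u) x t / (1 + (dx u x t)\<^sup>2))" if "0 < t" for x t
  proof -
    have "dt u x t / sqrt (1 + (dx u x t)\<^sup>2) = \<mu> * \<sigma> (\<alpha> t) * curvature u x t"
      using sol that unfolding global_solution_def by blast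
    moreover have "1 + (dx u x t)\<^sup>2 > 0" by (auto intro: add_pos_nonneg)
    then have "sqrt (1 + (dx u x t)\<^sup>2) \<noteq> 0" by simp
    ultimately have "dt u x t = \<mu> * \<sigma> (\<alpha> t) * curvature u x t * sqrt (1 + (dx u x t)\<^sup>2)"
      by (simp add: nonzero_divide_eq_eq)
    then show ?thesis
      unfolding curv[OF that] using \<open>sqrt (1 + (dx u x t)\<^sup>2) \<noteq> 0\<close> by simp
  qed

  \<comment> \<open>The truncation at \<open>1/2\<close> makes \<open>m\<close> continuous on all reals; the flow is only used from time 1.\<close>
  define m where "m t = \<mu> * \<sigma> (\<alpha> (max t (1/2)))" for t
  have contm: "isCont m t" for t
  proof -
    have "isCont \<alpha> s" if "0 < s" for s
      using continuous_on_interior[OF reg(3)[of "s" "s + 1"]] that by simp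
    then have "continuous_on {0<..} \<alpha>" by (auto intro: continuous_at_imp_continuous_on)
    then have "continuous_on UNIV (\<lambda>t. \<alpha> (max t (1/2)))"
      by (rule continuous_on_compose2) (auto intro!: continuous_intros)
    then have "continuous_on UNIV m"
      unfolding m_def
      by (intro continuous_intros continuous_on_compose2[OF C1_differentiable_imp_continuous_on[OF \<open>\<sigma> C1_differentiable_on UNIV\<close>]]) auto
    then show ?thesis by (simp add: continuous_on_eq_continuous_at)
  qed
  have mc: "c \<le> m t" for t unfolding c_def m_def using C1 \<open>\<mu> > 0\<close> by simp
  obtain M T where T: "\<And>t. T (M t) = t" "T 0 = 1"
    "\<And>t. 1 \<le> t \<Longrightarrow> c * (t - 1) \<le> M t"
    "\<And>s. 0 \<le> s \<Longrightarrow> 1 \<le> T s" "\<And>s. 0 \<le> s \<Longrightarrow> T s \<le> 1 + s / c"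
    "\<And>s. (T has_real_derivative 1 / m (T s)) (at s)"
    by (rule time_change[of m c 1, OF contm mc c]) (rule that)
  have Tpos: "0 < T s" if "0 \<le> s" for s using T(4)[OF that] by simp
  have mT: "\<mu> * \<sigma> (\<alpha> (T s)) = m (T s)" if "0 \<le> s" for s
    using T(4)[OF that] by (simp add: m_def max_def)
  \<comment> \<open>The chain rule contributes \<open>1 / m (T s)\<close>, which cancels the factor
    \<open>m (T s)\<close> of \<open>pde\<close>. As \<open>T s \<ge> 1\<close>, only positive times
    occur, where \<open>u\<close> is differentiable.\<close>
  interpret graph_flow "\<lambda>x s. u x (T s)" "\<lambda>x s. dx u x (T s)" "\<lambda>x s. dx (dx u) x (T s)"
  proof
    have "isCont (\<lambda>(x, t). u x t) z" if z: "z \<in> UNIV \<times> {0<..}" for z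
    proof -
      have "z \<in> interior (UNIV \<times> {0..snd z + 1})"
        using z by (cases z) (auto simp: interior_Times)
      then show ?thesis
        using continuous_on_interior[OF reg(1)[of "snd z" "snd z + 1"]] z by auto
    qed
    then have U: "continuous_on (UNIV \<times> {0<..}) (\<lambda>(x, t). u x t)"
      by (blast intro: continuous_at_imp_continuous_on)
    have "continuous_on UNIV T"
      using T(6) DERIV_isCont by (blast intro: continuous_at_imp_continuous_on)
    then have "continuous_on (UNIV \<times> {0..}) (\<lambda>z::real \<times> real. T (snd z))"
      by (rule continuous_on_compose2) (auto intro!: continuous_intros)
    then have "continuous_on (UNIV \<times> {0..}) (\<lambda>z. case (fst z, T (snd z)) of (x, t) \<Rightarrow> u x t)"
      by (intro continuous_on_compose2[OF U] continuous_intros) (use Tpos in auto)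
    then show "continuous_on (UNIV \<times> {0..}) (\<lambda>(x, s). u x (T s))"
      by (simp add: case_prod_unfold)
    fix x s :: real assume s: "0 \<le> s"
    show "u (x + 1) (T s) = u x (T s)" using per Tpos[OF s] by simp
    show "((\<lambda>y. u y (T s)) has_real_derivative dx u x (T s)) (at x)"
      "((\<lambda>y. dx u y (T s)) has_real_derivative dx (dx u) x (T s)) (at x)"
      using dux duxx Tpos[OF s] by blast+
    have "m (T s) \<noteq> 0" using mc[of "T s"] c by simp
    then have "dt u x (T s) * (1 / m (T s)) = dx (dx u) x (T s) / (1 + (dx u x (T s))\<^sup>2)"
      unfolding pde[OF Tpos[OF s]] mT[OF s] by simp
    then show "((\<lambda>s. u x (T s)) has_real_derivative dx (dx u) x (T s) / (1 + (dx u x (T s))\<^sup>2)) (at s)"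
      using DERIV_chain2[OF dut[OF Tpos[OF s], of x] T(6)[of s]] by simp
  qed

  \<comment> \<open>For \<open>s\<close> in \<open>[0, 1]\<close> the old time \<open>T s\<close>
    lies in \<open>[1, 1 + 1 / c]\<close>. The open interval \<open>I\<close> contains this range
    and stays away from 0, so the assumed regularity bounds the slope and the speed of
    \<open>u\<close> there.\<close>
  define I where "I = {1/2<..<2 + 1 / c}"
  have "parabolic_C2_on \<beta> (UNIV \<times> I) u"
    unfolding I_def using c by (intro reg(2)) (auto simp: add_pos_nonneg add_strict_increasing)
  then have "bounded ((\<lambda>(x, t). dx u x t) ` (UNIV \<times> I))" "bounded ((\<lambda>(x, t). dt u x t) ` (UNIV \<times> I))"
    unfolding parabolic_C2_on_def parabolic_holder_on_def bounded_continuous_on_def by simp_all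
  then obtain K R where "\<forall>z\<in>(\<lambda>(x, t). dx u x t) ` (UNIV \<times> I). norm z \<le> K"
    "\<forall>z\<in>(\<lambda>(x, t). dt u x t) ` (UNIV \<times> I). norm z \<le> R"
    unfolding bounded_iff by blast
  then have K: "\<bar>dx u x t\<bar> \<le> K" and R: "\<bar>dt u x t\<bar> \<le> R" if "t \<in> I" for x t
    using that by force+
  have K0: "\<bar>dx u x (T 0)\<bar> \<le> K" for x
    using K[of 1] c T(2) by (simp add: I_def add_pos_pos)
  have R1: "\<bar>dx (dx u) x (T s) / (1 + (dx u x (T s))\<^sup>2)\<bar> \<le> R / c" if s: "0 \<le> s" "s \<le> 1" for x s
  proof -
    have "T s \<le> 1 + 1 / c" using T(5)[OF s(1)] divide_right_mono[OF s(2), of c] c by simp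
    then have "T s \<in> I" using T(4)[OF s(1)] by (auto simp: I_def)
    then have "\<bar>dt u x (T s)\<bar> \<le> R" by (rule R)
    moreover have "c * \<bar>dx (dx u) x (T s) / (1 + (dx u x (T s))\<^sup>2)\<bar> \<le> \<bar>dt u x (T s)\<bar>"
      unfolding pde[OF Tpos[OF s(1)]] mT[OF s(1)] abs_mult[of "m (T s)"]
      using mc[of "T s"] c by (intro mult_right_mono) auto
    ultimately show ?thesis using c by (simp add: pos_le_divide_eq mult.commute)
  qed
  obtain B r L where B: "B > 0" "r > 0"
    and decay: "\<And>x s. 0 \<le> s \<Longrightarrow> \<bar>u x (T s) - L\<bar> \<le> B * exp (- r * s)"
      "\<And>x s. 0 \<le> s \<Longrightarrow> \<bar>dx u x (T s)\<bar> \<le> B * exp (- r * s)"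
      "\<And>x s. 0 \<le> s \<Longrightarrow> \<bar>dx (dx u) x (T s)\<bar> \<le> B * exp (- r * s)"
    by (rule exponential_decay[OF K0 R1]) (assumption | rule that)+
  \<comment> \<open>Decay holds in the new time \<open>M t \<ge> c * (t - 1)\<close>. This yields
    the rate \<open>r * c\<close>, and the factor \<open>exp (r * c)\<close> accounts for the start
    at time 1.\<close>
  define b where "b t = B * exp (r * c) * exp (- (r * c) * t)" for t
  have bounds: "\<bar>u x t - L\<bar> \<le> b t" "\<bar>dx u x t\<bar> \<le> b t" "\<bar>dx (dx u) x t\<bar> \<le> b t" if t: "1 \<le> t" for x t
  proof -
    have Mt: "0 \<le> c * (t - 1)" "c * (t - 1) \<le> M t" using T(3)[OF t] c t by auto
    have "r * (c * (t - 1)) \<le> r * M t" using Mt B by (intro mult_left_mono) auto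
    then have "B * exp (- r * M t) \<le> B * exp (r * c - (r * c) * t)"
      using B by (simp add: algebra_simps)
    also have "\<dots> = b t" by (simp add: b_def mult_exp_exp)
    finally have le: "B * exp (- r * M t) \<le> b t" .
    have "0 \<le> M t" using Mt by simp
    from decay[OF this] le show "\<bar>u x t - L\<bar> \<le> b t" "\<bar>dx u x t\<bar> \<le> b t" "\<bar>dx (dx u) x t\<bar> \<le> b t"
      unfolding T(1) by (meson order_trans)+
  qed
  have C2: "\<bar>C2_norm (\<lambda>x. u x t - L)\<bar> \<le> 3 * b t" if t: "1 \<le> t" for t
  proof -
    have d1: "deriv (\<lambda>x. u x t - L) = (\<lambda>x. dx u x t)"
      using t by (intro ext DERIV_imp_deriv) (auto intro!: derivative_eq_intros dux)
    have d2: "deriv (\<lambda>x. dx u x t) = (\<lambda>x. dx (dx u) x t)"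
      using t by (intro ext DERIV_imp_deriv duxx) auto
    have "\<bar>sup_norm (\<lambda>x. u x t - L)\<bar> \<le> b t" "\<bar>sup_norm (\<lambda>x. dx u x t)\<bar> \<le> b t"
      "\<bar>sup_norm (\<lambda>x. dx (dx u) x t)\<bar> \<le> b t"
      using bounds[OF t] by (auto intro: abs_sup_norm_le)
    then show ?thesis unfolding C2_norm_def d1 d2 by simp
  qed
  have curv_le: "\<bar>sup_norm (\<lambda>x. curvature u x t)\<bar> \<le> b t" if t: "1 \<le> t" for t
  proof (rule abs_sup_norm_le)
    fix x
    have "1 * 1 \<le> (1 + (dx u x t)\<^sup>2) * sqrt (1 + (dx u x t)\<^sup>2)" by (intro mult_mono) auto
    then have "\<bar>curvature u x t\<bar> \<le> \<bar>dx (dx u) x t\<bar> / 1"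
      using t unfolding curv[OF less_le_trans[OF zero_less_one t]] abs_divide
      by (intro divide_left_mono) auto
    then show "\<bar>curvature u x t\<bar> \<le> b t" using bounds(3)[OF t, of x] by simp
  qed
  have "exponentially_to_0 (\<lambda>t. C2_norm (\<lambda>x. u x t - L))"
    unfolding exponentially_to_0_def
    using C2 B c
    by (intro exI[of _ "3 * (B * exp (r * c))"] exI[of _ "r * c"] exI[of _ 1] conjI)
      (auto simp: b_def mult.assoc)
  moreover have "exponentially_to_0 (\<lambda>t. sup_norm (\<lambda>x. curvature u x t))"
    unfolding exponentially_to_0_def
    using curv_le B c
    by (intro exI[of _ "B * exp (r * c)"] exI[of _ "r * c"] exI[of _ 1] conjI)
      (auto simp: b_def mult.assoc)
  ultimately show ?thesis by blast
qed

end
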